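(* Let $n\in\mathbb{N}$, let $\Sigma$ be a finite alphabet, let $S\subseteq\Sigma^n$, and let $f\colon S\to\{0,1\}$ be non-constant. Then there exist distributions $\mu_0$ on $f^{-1}(0)$ and $\mu_1$ on $f^{-1}(1)$ such that for all randomized query algorithms $R$, \[\frac{\min\{\mathrm{cost}(R,\mu_0),\mathrm{cost}(R,\mu_1)\}}{\mathrm{h}^2(\mathrm{tran}(R,\mu_0),\mathrm{tran}(R,\mu_1))}\ge\frac{\mathrm{R}(f)}{3000},\] where $r/0=\infty$ for $r\in[0,\infty)$.
   Context: A randomized query algorithm is a probability distribution over finitely many deterministic decision trees on $\Sigma^n$. $\mathrm{cost}(R,\nu)$ is the expected number of queries made by $R$ on $x\leftarrow\nu$. $\mathrm{tran}(R,\nu)$ is the distribution of the pair (deterministic tree sampled from $R$, leaf it reaches) when $x\leftarrow\nu$. $\mathrm{R}(f)$ is the minimum worst-case number of queries of a randomized query algorithm that outputs $f(x)$ with probability at least $2/3$ for every $x\in S$. $\mathrm{h}^2(\nu_0,\nu_1)=\frac12\sum_z(\sqrt{\nu_0[z]}-\sqrt{\nu_1[z]})^2$. *)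

theory Defs
  imports "HOL-Probability.Probability"
begin

text \<open>
  Deterministic decision trees on \<open>\<Sigma>\<^sup>n\<close>, where \<open>\<Sigma>\<close> is the finite type \<open>'a\<close> and the
  coordinates are the elements of the finite type \<open>'n\<close>, so inputs are vectors in \<open>'a ^ 'n\<close>.
  A node \<open>Query i t\<close> queries coordinate \<open>i\<close> and continues in the subtree \<open>t c\<close> on answer \<open>c\<close>.
\<close>

datatype ('n, 'a) dtree = Output bool | Query 'n "'a \<Rightarrow> ('n, 'a) dtree"

primrec tree_output :: "('n, 'a) dtree \<Rightarrow> 'a ^ 'n \<Rightarrow> bool" where
  "tree_output (Output b) x = b"
| "tree_output (Query i t) x = tree_output (t (x $ i)) x"

primrec num_queries :: "('n, 'a) dtree \<Rightarrow> 'a ^ 'n \<Rightarrow> nat" where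
  "num_queries (Output b) x = 0"
| "num_queries (Query i t) x = Suc (num_queries (t (x $ i)) x)"

text \<open>
  A leaf is identified with the root-to-leaf path, recorded as the list of queried
  coordinates and answers; distinct leaves of one tree have distinct paths, whatever
  their output labels.
\<close>

primrec leaf :: "('n, 'a) dtree \<Rightarrow> 'a ^ 'n \<Rightarrow> ('n \<times> 'a) list" where
  "leaf (Output b) x = []"
| "leaf (Query i t) x = (i, x $ i) # leaf (t (x $ i)) x"

definition randomized_query_algorithm :: "('n, 'a) dtree pmf \<Rightarrow> bool" where
  "randomized_query_algorithm R \<longleftrightarrow> finite (set_pmf R)"

definition cost :: "('n, 'a) dtree pmf \<Rightarrow> ('a ^ 'n) pmf \<Rightarrow> real" where
  "cost R \<nu> = measure_pmf.expectation (pair_pmf R \<nu>) (\<lambda>(D, x). real (num_queries D x))"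

definition tran ::
  "('n, 'a) dtree pmf \<Rightarrow> ('a ^ 'n) pmf \<Rightarrow> (('n, 'a) dtree \<times> ('n \<times> 'a) list) pmf" where
  "tran R \<nu> = map_pmf (\<lambda>(D, x). (D, leaf D x)) (pair_pmf R \<nu>)"

definition hellinger_sq :: "'z pmf \<Rightarrow> 'z pmf \<Rightarrow> real" where
  "hellinger_sq \<nu>0 \<nu>1 = 1 / 2 * (\<Sum>\<^sub>\<infinity>z. (sqrt (pmf \<nu>0 z) - sqrt (pmf \<nu>1 z))\<^sup>2)"

text \<open>A partial function on \<open>S\<close> is a total function of which only the values on \<open>S\<close> are used.\<close>

definition computes :: "('n, 'a) dtree pmf \<Rightarrow> ('a ^ 'n) set \<Rightarrow> ('a ^ 'n \<Rightarrow> bool) \<Rightarrow> bool" where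
  "computes R S f \<longleftrightarrow> (\<forall>x\<in>S. measure_pmf.prob R {D. tree_output D x = f x} \<ge> 2 / 3)"

definition worst_case_queries :: "('n, 'a) dtree pmf \<Rightarrow> ('a ^ 'n) set \<Rightarrow> nat" where
  "worst_case_queries R S = Max {num_queries D x | D x. D \<in> set_pmf R \<and> x \<in> S}"

definition randomized_query_complexity :: "('a ^ 'n) set \<Rightarrow> ('a ^ 'n \<Rightarrow> bool) \<Rightarrow> nat" where
  "randomized_query_complexity S f =
     (LEAST T. \<exists>R. randomized_query_algorithm R \<and> computes R S f \<and> worst_case_queries R S = T)"

text \<open>
  Division with \<open>r / 0 = \<infinity>\<close> for all \<open>r \<ge> 0\<close>, including \<open>0 / 0\<close>; the library divisions on
  extended (nonnegative) reals give a different value for \<open>0 / 0\<close>.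
\<close>

definition ratio :: "real \<Rightarrow> real \<Rightarrow> ereal" where
  "ratio r s = (if s = 0 then \<infinity> else ereal (r / s))"

end

theory Submission
  imports Defs
begin

text \<open>
  Suppose that no pair of distributions is hard, and let \<open>T\<close> be the randomized query complexity.
  Since the squared Hellinger distance of transcripts is the average over the trees of the squared
  Hellinger distance of their leaf distributions, each pair \<open>\<mu>0, \<mu>1\<close> admits a single tree that is
  cheap, relative to its distance, on one of the two distributions. Stopping it once the likelihood
  ratio becomes one-sided makes it cheap on both. By AM-GM, the squared Hellinger distance is up to a
  constant the expected score of a forecaster that outputs \<open>r > 0\<close> at its leaves and scores
  \<open>1 - r\<close> on 0-inputs and \<open>1 - 1 / r\<close> on 1-inputs. Hyperplane separation exchanges the quantifiers:
  some mixture of forecasters has, on every input, expected cost below \<open>T / 240\<close> times its expected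
  score \<open>s\<close>. (A separating hyperplane gives the 0-inputs and the 1-inputs the same weight, because
  constant forecasts, which cost nothing, exploit any imbalance.) Scores amplify under independent
  repetition by multiplying forecasts, as the expectation of the product of \<open>m\<close> forecasts is
  \<open>(1 - s) ^ m\<close>. Repeating until \<open>T - 1\<close> queries are used up allows more than about \<open>2 / s\<close> runs with
  high probability, without knowing \<open>s\<close>, and so computes \<open>f\<close> with fewer than \<open>T\<close> queries.
\<close>

section \<open>Finite mixtures\<close>

lemma pmf_of_weights:
  fixes w :: "'x \<Rightarrow> real"
  assumes "finite A" and "\<And>x. x \<in> A \<Longrightarrow> 0 \<le> w x" and "sum w A = 1"
  obtains p where "set_pmf p \<subseteq> A" and "\<And>x. pmf p x = (if x \<in> A then w x else 0)"
proof -
  let ?w = "\<lambda>x. if x \<in> A then w x else 0"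
  have "(\<integral>\<^sup>+ x. ennreal (?w x) \<partial>count_space UNIV) = (\<Sum>x\<in>A. ennreal (?w x))"
    by (rule nn_integral_count_space'[OF assms(1)]) auto
  also have "\<dots> = ennreal (\<Sum>x\<in>A. ?w x)"
    by (rule sum_ennreal) (use assms(2) in auto)
  also have "(\<Sum>x\<in>A. ?w x) = sum w A"
    by (rule sum.cong) auto
  finally have int: "(\<integral>\<^sup>+ x. ennreal (?w x) \<partial>count_space UNIV) = 1"
    using assms(3) by simp
  have nn: "0 \<le> ?w x" for x
    using assms(2) by auto
  have "pmf (embed_pmf ?w) x = ?w x" for x
    by (rule pmf_embed_pmf[OF nn int])
  moreover have "set_pmf (embed_pmf ?w) \<subseteq> A"
    using set_embed_pmf[OF nn int] by auto
  ultimately show thesis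
    using that by blast
qed

lemma expectation_finite:
  fixes h :: "'x \<Rightarrow> real"
  assumes "finite A" and "set_pmf p \<subseteq> A"
  shows "measure_pmf.expectation p h = (\<Sum>a\<in>A. pmf p a * h a)"
  using integral_measure_pmf[OF assms(1), of p h] assms(2) by auto

lemma prob_replicate_pmf_Suc:
  assumes "finite (set_pmf p)"
  shows "measure_pmf.prob (replicate_pmf (Suc n) p) {ts. Q ts} =
           (\<Sum>t\<in>set_pmf p. pmf p t * measure_pmf.prob (replicate_pmf n p) {ts. Q (t # ts)})"
proof -
  let ?g = "\<lambda>t. measure_pmf.prob (replicate_pmf n p) {ts. Q (t # ts)}"
  have "replicate_pmf (Suc n) p = bind_pmf p (\<lambda>t. map_pmf ((#) t) (replicate_pmf n p))"
    by (simp add: map_pmf_def)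
  then have "emeasure (replicate_pmf (Suc n) p) {ts. Q ts} =
      (\<integral>\<^sup>+ t. emeasure (map_pmf ((#) t) (replicate_pmf n p)) {ts. Q ts} \<partial>p)"
    by (simp only: emeasure_bind_pmf)
  also have "\<dots> = (\<integral>\<^sup>+ t. ennreal (?g t) \<partial>p)"
    by (simp add: measure_pmf.emeasure_eq_measure vimage_def)
  also have "\<dots> = ennreal (measure_pmf.expectation p ?g)"
    by (intro nn_integral_eq_integral integrable_measure_pmf_finite assms) auto
  finally have "measure_pmf.prob (replicate_pmf (Suc n) p) {ts. Q ts} = measure_pmf.expectation p ?g"
    by (simp add: measure_pmf.emeasure_eq_measure del: replicate_pmf.simps)
  then show ?thesis
    using expectation_finite[OF assms order.refl] by simp
qed

lemma finite_set_replicate_pmf: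
  "finite (set_pmf p) \<Longrightarrow> finite (set_pmf (replicate_pmf n p))"
  by (induction n) auto

lemma set_replicate_pmf_subset:
  "ts \<in> set_pmf (replicate_pmf n p) \<Longrightarrow> set ts \<subseteq> set_pmf p"
  by (induction n arbitrary: ts) (auto, blast)

text \<open>Theorem of alternatives. If the convex hull of the payoff vectors meets the vectors
  positive on \<open>S\<close>, a common point is a finite convex combination, hence a finite
  mixture even for infinite \<open>A\<close>. Otherwise a hyperplane weakly separates the two convex
  sets, and its normal gives \<open>a\<close>.\<close>

lemma mixture_or_weights:
  fixes g :: "'t \<Rightarrow> 'x::finite \<Rightarrow> real"
  assumes "A \<noteq> {}"
  obtains (mixture) p where "finite (set_pmf p)" and "set_pmf p \<subseteq> A"
      and "\<And>x. x \<in> S \<Longrightarrow> 0 < measure_pmf.expectation p (\<lambda>t. g t x)"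
  | (weights) a where "\<And>x. 0 \<le> a x" and "\<And>x. x \<notin> S \<Longrightarrow> a x = 0" and "\<exists>x. a x \<noteq> 0"
      and "\<And>t. t \<in> A \<Longrightarrow> (\<Sum>x\<in>UNIV. a x * g t x) \<le> 0"
proof -
  define G where "G t = (\<chi> x. g t x)" for t
  define C where "C = convex hull (G ` A)"
  define Q where "Q = {y :: real ^ 'x. \<forall>x\<in>S. 0 < y $ x}"
  show thesis
  proof (cases "C \<inter> Q = {}")
    case False
    then obtain y where "y \<in> C" and y: "\<And>x. x \<in> S \<Longrightarrow> 0 < y $ x"
      by (auto simp: Q_def)
    then obtain V u where V: "finite V" "V \<subseteq> G ` A" "\<And>v. v \<in> V \<Longrightarrow> 0 \<le> u v" "sum u V = 1"
      and yV: "(\<Sum>v\<in>V. u v *\<^sub>R v) = y"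
      unfolding C_def convex_hull_explicit by blast
    obtain p where p: "set_pmf p \<subseteq> V" "\<And>v. pmf p v = (if v \<in> V then u v else 0)"
      using pmf_of_weights[OF V(1,3,4)] by blast
    have G_inv: "inv_into A G v \<in> A" "G (inv_into A G v) = v" if "v \<in> V" for v
      using that V(2) by (auto intro: inv_into_into f_inv_into_f)
    have "measure_pmf.expectation (map_pmf (inv_into A G) p) (\<lambda>t. g t x) = y $ x" for x
    proof -
      have "measure_pmf.expectation (map_pmf (inv_into A G) p) (\<lambda>t. g t x) =
          (\<Sum>v\<in>V. u v * g (inv_into A G v) x)"
        using expectation_finite[OF V(1) p(1)] p(2) by simp
      also have "\<dots> = (\<Sum>v\<in>V. u v * v $ x)"
      proof (rule sum.cong[OF refl])
        fix v assume "v \<in> V"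
        from G_inv(2)[OF this] have "G (inv_into A G v) $ x = v $ x"
          by simp
        then show "u v * g (inv_into A G v) x = u v * v $ x"
          by (simp add: G_def)
      qed
      finally show ?thesis
        by (simp flip: yV)
    qed
    moreover have "finite (set_pmf p)"
      using V(1) p(1) finite_subset by blast
    ultimately show thesis
      using mixture[of "map_pmf (inv_into A G) p"] y p(1) G_inv(1) by auto
  next
    case True
    have "convex Q"
    proof (rule convexI)
      fix y z :: "real ^ 'x" and c d :: real
      assume "y \<in> Q" "z \<in> Q" "0 \<le> c" "0 \<le> d" "c + d = 1"
      moreover have "0 < c * y $ x + d * z $ x" if "0 < y $ x" "0 < z $ x" for x
        using that \<open>0 \<le> c\<close> \<open>0 \<le> d\<close> \<open>c + d = 1\<close>
        by (cases "c = 0") (auto intro: add_pos_nonneg)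
      ultimately show "c *\<^sub>R y + d *\<^sub>R z \<in> Q"
        by (simp add: Q_def)
    qed
    moreover have "(\<chi> x. 1) \<in> Q"
      by (simp add: Q_def)
    moreover have "C \<noteq> {}" "convex C"
      using assms by (auto simp: C_def convex_hull_eq_empty)
    ultimately obtain a b where "a \<noteq> 0" and C: "\<forall>y\<in>C. a \<bullet> y \<le> b" and Q: "\<forall>y\<in>Q. b \<le> a \<bullet> y"
      using separating_hyperplane_sets[OF _ _ _ _ True] by blast
    define s where "s = (\<Sum>x\<in>UNIV. a $ x)"
    \<comment> \<open>These test points of \<open>Q\<close> equal \<open>\<epsilon>\<close> except
      at \<open>z\<close>. Small \<open>\<epsilon>\<close> yields \<open>b \<le> 0\<close>, large
      \<open>k\<close> yields \<open>0 \<le> a $ z\<close>, and outside \<open>S\<close> both signs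
      of \<open>k\<close> are allowed, which forces \<open>a $ z = 0\<close>.\<close>
    have b_le: "b \<le> \<epsilon> * s + k * a $ z" if "0 < \<epsilon>" "z \<in> S \<Longrightarrow> 0 \<le> k" for \<epsilon> k z
    proof -
      let ?y = "(\<chi> x. \<epsilon> + (if x = z then k else 0)) :: real ^ 'x"
      have "?y \<in> Q"
        using that by (auto simp: Q_def)
      moreover have "a \<bullet> ?y = \<epsilon> * s + k * a $ z"
      proof -
        have "a \<bullet> ?y = (\<Sum>x\<in>UNIV. \<epsilon> * a $ x + (if x = z then k * a $ x else 0))"
          unfolding inner_vec_def by (rule sum.cong) (auto simp: algebra_simps)
        then show ?thesis
          by (simp add: sum.distrib s_def sum_distrib_left)
      qed
      ultimately show ?thesis
        using Q by metis
    qed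
    have "b \<le> 0"
    proof (rule field_le_epsilon)
      fix e :: real assume "0 < e"
      have "b \<le> e / (\<bar>s\<bar> + 1) * s"
        using b_le[where \<epsilon> = "e / (\<bar>s\<bar> + 1)" and k = 0] \<open>0 < e\<close> by simp
      also have "\<dots> \<le> e / (\<bar>s\<bar> + 1) * (\<bar>s\<bar> + 1)"
        using \<open>0 < e\<close> by (intro mult_left_mono) auto
      finally show "b \<le> 0 + e"
        by simp
    qed
    have "0 \<le> a $ z" for z
    proof (rule ccontr)
      assume "\<not> 0 \<le> a $ z"
      then have "(\<bar>s - b\<bar> + 1) / - a $ z * a $ z = - (\<bar>s - b\<bar> + 1)" "0 \<le> (\<bar>s - b\<bar> + 1) / - a $ z"
        by (auto simp: field_simps)
      then show False
        using b_le[of 1 z "(\<bar>s - b\<bar> + 1) / - a $ z"] by simp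
    qed
    moreover have "a $ z = 0" if "z \<notin> S" for z
    proof (rule ccontr)
      assume "a $ z \<noteq> 0"
      then have "(- (\<bar>s - b\<bar> + 1)) / a $ z * a $ z = - (\<bar>s - b\<bar> + 1)"
        by simp
      then show False
        using b_le[of 1 z "(- (\<bar>s - b\<bar> + 1)) / a $ z"] that by simp
    qed
    moreover have "\<exists>x. a $ x \<noteq> 0"
      using \<open>a \<noteq> 0\<close> by (auto simp: vec_eq_iff)
    moreover have "(\<Sum>x\<in>UNIV. a $ x * g t x) \<le> 0" if "t \<in> A" for t
    proof -
      have "G t \<in> C"
        using that by (simp add: C_def hull_inc)
      then have "a \<bullet> G t \<le> 0"
        using C \<open>b \<le> 0\<close> by fastforce
      then show ?thesis
        by (simp add: inner_vec_def G_def)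
    qed
    ultimately show thesis
      by (rule weights)
  qed
qed

section \<open>Forecasting trees\<close>

text \<open>
  A label is a guess of the square root of the likelihood ratio of \<open>f x = True\<close> against
  \<open>f x = False\<close>.
\<close>

datatype ('n, 'a) ftree = Forecast real | Ask 'n "'a \<Rightarrow> ('n, 'a) ftree"

primrec forecast :: "('n, 'a) ftree \<Rightarrow> 'a ^ 'n \<Rightarrow> real" where
  "forecast (Forecast r) x = r"
| "forecast (Ask i t) x = forecast (t (x $ i)) x"

primrec num_asks :: "('n, 'a) ftree \<Rightarrow> 'a ^ 'n \<Rightarrow> nat" where
  "num_asks (Forecast r) x = 0"
| "num_asks (Ask i t) x = Suc (num_asks (t (x $ i)) x)"

text \<open>Exchanges the scores that a forecaster gets on 0-inputs and on 1-inputs.\<close>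

primrec invert :: "('n, 'a) ftree \<Rightarrow> ('n, 'a) ftree" where
  "invert (Forecast r) = Forecast (1 / r)"
| "invert (Ask i t) = Ask i (\<lambda>c. invert (t c))"

lemma forecast_invert [simp]: "forecast (invert t) x = 1 / forecast t x"
  by (induction t) auto

lemma num_asks_invert [simp]: "num_asks (invert t) x = num_asks t x"
  by (induction t) auto

definition score :: "('a ^ 'n \<Rightarrow> bool) \<Rightarrow> ('n, 'a) ftree \<Rightarrow> 'a ^ 'n \<Rightarrow> real" where
  "score f t x = (if f x then 1 - 1 / forecast t x else 1 - forecast t x)"

text \<open>Since \<open>1 / 0 = 0\<close>, the forecast 0 would score 1 on every input; positivity
  excludes it.\<close>

definition positive_forecasts :: "('n::finite, 'a) ftree \<Rightarrow> bool" where
  "positive_forecasts t \<longleftrightarrow> (\<forall>x. 0 < forecast t x)"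

section \<open>Hellinger distance of leaf distributions\<close>

text \<open>A tree that queries a coordinate twice has paths that no input follows; they are
  included here and carry mass 0.\<close>

primrec leaves :: "('n, 'a) dtree \<Rightarrow> ('n \<times> 'a) list set" where
  "leaves (Output b) = {[]}"
| "leaves (Query i t) = (\<Union>c. (#) (i, c) ` leaves (t c))"

lemma leaf_in_leaves: "leaf D x \<in> leaves D"
proof (induction D)
  case (Query i t)
  then show ?case
    by (auto intro!: exI[of _ "x $ i"])
qed simp

lemma finite_leaves: "finite (leaves (D :: ('n, 'a::finite) dtree))"
  by (induction D) auto

text \<open>The weights are unnormalised and \<open>X\<close> stands for the inputs that reach the
  current node, so that induction on the tree needs no conditioning.\<close>

definition leaf_mass ::
  "('a ^ 'n \<Rightarrow> real) \<Rightarrow> ('n, 'a) dtree \<Rightarrow> ('a ^ 'n) set \<Rightarrow> ('n \<times> 'a) list \<Rightarrow> real" where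
  "leaf_mass u D X l = (\<Sum>x | x \<in> X \<and> leaf D x = l. u x)"

text \<open>For probability weights and \<open>X = UNIV\<close> this is twice the squared Hellinger
  distance of the leaf distributions.\<close>

definition leaf_distance ::
  "('a ^ 'n \<Rightarrow> real) \<Rightarrow> ('a ^ 'n \<Rightarrow> real) \<Rightarrow> ('n, 'a) dtree \<Rightarrow> ('a ^ 'n) set \<Rightarrow> real" where
  "leaf_distance u w D X =
     (\<Sum>l\<in>leaves D. (sqrt (leaf_mass u D X l) - sqrt (leaf_mass w D X l))\<^sup>2)"

lemma leaf_distance_commute: "leaf_distance u w D X = leaf_distance w u D X"
  by (simp add: leaf_distance_def power2_commute)

lemma leaf_distance_Output: "leaf_distance u w (Output b) X = (sqrt (sum u X) - sqrt (sum w X))\<^sup>2"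
  by (simp add: leaf_distance_def leaf_mass_def)

lemma leaf_distance_Query:
  fixes t :: "'a::finite \<Rightarrow> ('n::finite, 'a) dtree"
  shows "leaf_distance u w (Query i t) X = (\<Sum>c\<in>UNIV. leaf_distance u w (t c) {x \<in> X. x $ i = c})"
proof -
  have mass: "leaf_mass v (Query i t) X ((i, c) # l) = leaf_mass v (t c) {x \<in> X. x $ i = c} l" for v c l
    unfolding leaf_mass_def by (rule sum.cong) auto
  show ?thesis
    unfolding leaf_distance_def leaves.simps
    by (subst sum.UNION_disjoint) (auto simp: finite_leaves sum.reindex mass)
qed

lemma sum_split_coordinate:
  fixes X :: "('a::finite ^ 'n::finite) set"
  shows "(\<Sum>x\<in>X. h x) = (\<Sum>c\<in>UNIV. \<Sum>x\<in>{x \<in> X. x $ i = c}. h x)"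
  using sum.group[of X UNIV "\<lambda>x. x $ i" h] by simp

lemma sq_diff_sqrt_le_add:
  assumes "0 \<le> p" and "0 \<le> q"
  shows "(sqrt p - sqrt q)\<^sup>2 \<le> p + q"
  using assms by (simp add: power2_diff)

text \<open>Bounds what a subtree discarded by stopping could have contributed.\<close>

lemma leaf_distance_le:
  fixes D :: "('n::finite, 'a::finite) dtree"
  assumes "\<And>x. 0 \<le> u x" and "\<And>x. 0 \<le> w x"
  shows "leaf_distance u w D X \<le> sum u X + sum w X"
proof (induction D arbitrary: X)
  case (Output b)
  show ?case
    by (simp add: leaf_distance_Output sq_diff_sqrt_le_add sum_nonneg assms)
next
  case (Query i t)
  have "leaf_distance u w (Query i t) X \<le>
      (\<Sum>c\<in>UNIV. sum u {x \<in> X. x $ i = c} + sum w {x \<in> X. x $ i = c})"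
    unfolding leaf_distance_Query by (rule sum_mono) (use Query in auto)
  then show ?case
    by (simp add: sum.distrib sum_split_coordinate[of _ X i])
qed

text \<open>By AM-GM the optimal forecast is \<open>sqrt q / sqrt p\<close>, and it attains the
  squared difference exactly. If one of the masses is 0, the optimum is only approached; the
  forecast 2 or 1/2 then attains half of it, hence the factor 2.\<close>

lemma best_forecast:
  fixes p q :: real
  assumes "0 \<le> p" and "0 \<le> q"
  obtains r where "0 < r" and "(sqrt p - sqrt q)\<^sup>2 \<le> 2 * (p * (1 - r) + q * (1 - 1 / r))"
    and "p \<noteq> q \<Longrightarrow> 0 < p * (1 - r) + q * (1 - 1 / r)"
proof -
  consider "p = 0" | "q = 0" | "0 < p" "0 < q"
    using assms by linarith
  then show thesis
  proof cases
    case 1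
    then show thesis
      using that[of 2] assms by simp
  next
    case 2
    then show thesis
      using that[of "1 / 2"] assms by simp
  next
    case 3
    let ?P = "sqrt p" and ?Q = "sqrt q"
    have "0 < ?P" "0 < ?Q"
      using 3 by simp_all
    then have "?P\<^sup>2 * (1 - ?Q / ?P) + ?Q\<^sup>2 * (1 - 1 / (?Q / ?P)) = (?P - ?Q)\<^sup>2"
      by (simp add: field_simps power2_eq_square)
    then have eq: "p * (1 - ?Q / ?P) + q * (1 - 1 / (?Q / ?P)) = (?P - ?Q)\<^sup>2"
      using 3 by simp
    show thesis
    proof (rule that[of "?Q / ?P"])
      show "0 < ?Q / ?P"
        using 3 by simp
      show "(?P - ?Q)\<^sup>2 \<le> 2 * (p * (1 - ?Q / ?P) + q * (1 - 1 / (?Q / ?P)))"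
        unfolding eq by simp
      show "0 < p * (1 - ?Q / ?P) + q * (1 - 1 / (?Q / ?P))" if "p \<noteq> q"
        unfolding eq using that by simp
    qed
  qed
qed

text \<open>
  The forecaster follows \<open>D\<close> but stops as soon as the \<open>w\<close>-mass of the current node exceeds four
  times its \<open>u\<close>-mass. At visited nodes the two masses are thus comparable in the direction needed
  to bound the \<open>w\<close>-cost by the \<open>u\<close>-cost, while a stopped node has already realised a constant
  fraction of the distance that its subtree could contribute.
\<close>

lemma stopped_forecaster:
  fixes D :: "('n::finite, 'a::finite) dtree"
  assumes u: "\<And>x. 0 \<le> u x" and w: "\<And>x. 0 \<le> w x"
  shows "\<exists>t. positive_forecasts t \<and>
    leaf_distance u w D X \<le> 5 * (\<Sum>x\<in>X. u x * (1 - forecast t x) + w x * (1 - 1 / forecast t x)) \<and>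
    (\<Sum>x\<in>X. w x * num_asks t x) \<le> 4 * (\<Sum>x\<in>X. u x * num_asks t x) \<and>
    (\<Sum>x\<in>X. u x * num_asks t x) \<le> (\<Sum>x\<in>X. u x * num_queries D x)"
proof (induction D arbitrary: X)
  case (Output b)
  have "0 \<le> sum u X" "0 \<le> sum w X"
    by (simp_all add: sum_nonneg u w)
  then obtain r where r: "0 < r"
    "(sqrt (sum u X) - sqrt (sum w X))\<^sup>2 \<le> 2 * (sum u X * (1 - r) + sum w X * (1 - 1 / r))"
    using best_forecast by metis
  moreover have "0 \<le> (sqrt (sum u X) - sqrt (sum w X))\<^sup>2"
    by simp
  ultimately have "(sqrt (sum u X) - sqrt (sum w X))\<^sup>2 \<le> 5 * (sum u X * (1 - r) + sum w X * (1 - 1 / r))"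
    by linarith
  then show ?case
    using r(1) by (intro exI[of _ "Forecast r"])
      (simp add: leaf_distance_Output positive_forecasts_def sum.distrib sum_distrib_right)
next
  case (Query i t)
  show ?case
  proof (cases "sum w X > 4 * sum u X")
    case True
    have "leaf_distance u w (Query i t) X \<le> sum u X + sum w X"
      by (intro leaf_distance_le u w)
    \<comment> \<open>The forecast 2 scores \<open>sum w X / 2 - sum u X\<close>. Five times this is
      at least \<open>sum u X + sum w X\<close> exactly when \<open>sum w X\<close> is at least
      \<open>4 * sum u X\<close>, which ties the factor 5 to the threshold 4.\<close>
    also have "\<dots> \<le> 5 * (sum u X * (1 - 2) + sum w X * (1 - 1 / 2))"
      using True by simp
    also have "\<dots> = 5 * (\<Sum>x\<in>X. u x * (1 - 2) + w x * (1 - 1 / 2))"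
      by (simp only: sum.distrib sum_distrib_right)
    finally show ?thesis
      by (intro exI[of _ "Forecast 2"]) (simp add: positive_forecasts_def sum_nonneg u)
  next
    case False
    let ?X = "\<lambda>c. {x \<in> X. x $ i = c}"
    let ?good = "\<lambda>c t'. positive_forecasts t' \<and>
      leaf_distance u w (t c) (?X c) \<le>
        5 * (\<Sum>x\<in>?X c. u x * (1 - forecast t' x) + w x * (1 - 1 / forecast t' x)) \<and>
      (\<Sum>x\<in>?X c. w x * num_asks t' x) \<le> 4 * (\<Sum>x\<in>?X c. u x * num_asks t' x) \<and>
      (\<Sum>x\<in>?X c. u x * num_asks t' x) \<le> (\<Sum>x\<in>?X c. u x * num_queries (t c) x)"
    have "\<forall>c. \<exists>t'. ?good c t'"
      by (intro allI Query rangeI)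
    from choice[OF this] obtain t' where good: "\<forall>c. ?good c (t' c)"
      by (elim exE)
    have t': "positive_forecasts (t' c)"
      "leaf_distance u w (t c) (?X c) \<le>
        5 * (\<Sum>x\<in>?X c. u x * (1 - forecast (t' c) x) + w x * (1 - 1 / forecast (t' c) x))"
      "(\<Sum>x\<in>?X c. w x * num_asks (t' c) x) \<le> 4 * (\<Sum>x\<in>?X c. u x * num_asks (t' c) x)"
      "(\<Sum>x\<in>?X c. u x * num_asks (t' c) x) \<le> (\<Sum>x\<in>?X c. u x * num_queries (t c) x)" for c
      using spec[OF good, of c] by blast+
    have asks: "(\<Sum>x\<in>X. v x * num_asks (Ask i t') x) =
        sum v X + (\<Sum>c\<in>UNIV. \<Sum>x\<in>?X c. v x * num_asks (t' c) x)" for v :: "'a ^ 'n \<Rightarrow> real"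
      by (simp add: distrib_left sum.distrib sum_split_coordinate[of "\<lambda>x. v x * num_asks (t' (x $ i)) x" X i])
    have queries: "(\<Sum>x\<in>X. u x * num_queries (Query i t) x) =
        sum u X + (\<Sum>c\<in>UNIV. \<Sum>x\<in>?X c. u x * num_queries (t c) x)"
      by (simp add: distrib_left sum.distrib sum_split_coordinate[of "\<lambda>x. u x * num_queries (t (x $ i)) x" X i])
    have "leaf_distance u w (Query i t) X \<le> (\<Sum>c\<in>UNIV.
        5 * (\<Sum>x\<in>?X c. u x * (1 - forecast (t' c) x) + w x * (1 - 1 / forecast (t' c) x)))"
      unfolding leaf_distance_Query by (rule sum_mono) (rule t'(2))
    also have "\<dots> = 5 * (\<Sum>x\<in>X. u x * (1 - forecast (Ask i t') x) + w x * (1 - 1 / forecast (Ask i t') x))"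
      by (subst sum_split_coordinate[of _ X i]) (simp add: sum_distrib_left)
    finally have dist: "leaf_distance u w (Query i t) X \<le>
        5 * (\<Sum>x\<in>X. u x * (1 - forecast (Ask i t') x) + w x * (1 - 1 / forecast (Ask i t') x))" .
    have "(\<Sum>c\<in>UNIV. \<Sum>x\<in>?X c. w x * num_asks (t' c) x) \<le>
        (\<Sum>c\<in>UNIV. 4 * (\<Sum>x\<in>?X c. u x * num_asks (t' c) x))"
      by (rule sum_mono) (rule t'(3))
    \<comment> \<open>The query at the current node adds \<open>sum w X\<close> on the left and
      \<open>4 * sum u X\<close> on the right; not having stopped here makes this harmless.\<close>
    then have "(\<Sum>x\<in>X. w x * num_asks (Ask i t') x) \<le> 4 * (\<Sum>x\<in>X. u x * num_asks (Ask i t') x)"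
      unfolding asks using False by (simp flip: sum_distrib_left)
    moreover have "(\<Sum>x\<in>X. u x * num_asks (Ask i t') x) \<le> (\<Sum>x\<in>X. u x * num_queries (Query i t) x)"
      unfolding asks queries by (intro add_left_mono sum_mono t'(4))
    moreover have "positive_forecasts (Ask i t')"
      using t'(1) by (simp add: positive_forecasts_def)
    ultimately show ?thesis
      using dist by blast
  qed
qed

text \<open>The stopping rule treats \<open>u\<close> and \<open>w\<close> asymmetrically. If
  \<open>D\<close> is cheap under \<open>w\<close>, the forecaster is built with the roles exchanged
  and then inverted. The cost factor is 1 + 4.\<close>

lemma cheap_forecaster:
  fixes D :: "('n::finite, 'a::finite) dtree"
  assumes u: "\<And>x. 0 \<le> u x" and w: "\<And>x. 0 \<le> w x" and "v = u \<or> v = w"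
  obtains t where "positive_forecasts t"
    and "leaf_distance u w D UNIV \<le>
      5 * (\<Sum>x\<in>UNIV. u x * (1 - forecast t x) + w x * (1 - 1 / forecast t x))"
    and "(\<Sum>x\<in>UNIV. (u x + w x) * num_asks t x) \<le> 5 * (\<Sum>x\<in>UNIV. v x * num_queries D x)"
  using assms(3)
proof
  assume v: "v = u"
  show thesis
    using stopped_forecaster[of u w D UNIV, OF u w] that
    by (force simp: v distrib_right sum.distrib)
next
  assume v: "v = w"
  obtain t where t: "positive_forecasts t"
    "leaf_distance w u D UNIV \<le> 5 * (\<Sum>x\<in>UNIV. w x * (1 - forecast t x) + u x * (1 - 1 / forecast t x))"
    "(\<Sum>x\<in>UNIV. u x * num_asks t x) \<le> 4 * (\<Sum>x\<in>UNIV. w x * num_asks t x)"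
    "(\<Sum>x\<in>UNIV. w x * num_asks t x) \<le> (\<Sum>x\<in>UNIV. w x * num_queries D x)"
    using stopped_forecaster[of w u D UNIV, OF w u] by blast
  show thesis
  proof (rule that[of "invert t"])
    show "positive_forecasts (invert t)"
      using t(1) by (simp add: positive_forecasts_def)
    show "leaf_distance u w D UNIV \<le>
      5 * (\<Sum>x\<in>UNIV. u x * (1 - forecast (invert t) x) + w x * (1 - 1 / forecast (invert t) x))"
      using t(2) by (simp add: leaf_distance_commute[of u w] add.commute)
    show "(\<Sum>x\<in>UNIV. (u x + w x) * num_asks (invert t) x) \<le> 5 * (\<Sum>x\<in>UNIV. v x * num_queries D x)"
      using t(3,4) by (simp add: v distrib_right sum.distrib)
  qed
qed

section \<open>Costs and transcripts as averages over the sampled tree\<close>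

lemma cost_eq_sum:
  fixes \<nu> :: "('a::finite ^ 'n::finite) pmf"
  assumes "finite (set_pmf R)"
  shows "cost R \<nu> = (\<Sum>D\<in>set_pmf R. pmf R D * (\<Sum>x\<in>UNIV. pmf \<nu> x * num_queries D x))"
proof -
  have "cost R \<nu> = (\<Sum>z\<in>set_pmf R \<times> UNIV. pmf (pair_pmf R \<nu>) z * (case z of (D, x) \<Rightarrow> real (num_queries D x)))"
    unfolding cost_def by (rule expectation_finite) (use assms in auto)
  also have "\<dots> = (\<Sum>(D, x)\<in>set_pmf R \<times> UNIV. pmf R D * (pmf \<nu> x * num_queries D x))"
    by (rule sum.cong) (auto simp: pmf_pair)
  finally show ?thesis
    by (simp add: sum_distrib_left flip: sum.cartesian_product)
qed

lemma pmf_tran: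
  fixes \<nu> :: "('a::finite ^ 'n::finite) pmf"
  shows "pmf (tran R \<nu>) (D, l) = pmf R D * leaf_mass (pmf \<nu>) D UNIV l"
proof -
  have "pmf (tran R \<nu>) (D, l) = measure_pmf.prob (pair_pmf R \<nu>) ({D} \<times> {x. leaf D x = l})"
    unfolding tran_def pmf_map by (rule arg_cong[where f = "measure _"]) auto
  also have "\<dots> = (\<Sum>z\<in>{D} \<times> {x. leaf D x = l}. pmf (pair_pmf R \<nu>) z)"
    by (rule measure_measure_pmf_finite) auto
  also have "\<dots> = (\<Sum>(D', x)\<in>{D} \<times> {x. leaf D x = l}. pmf R D' * pmf \<nu> x)"
    by (rule sum.cong) (auto simp: pmf_pair)
  finally show ?thesis
    by (simp add: leaf_mass_def sum_distrib_left flip: sum.cartesian_product)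
qed

text \<open>The tree in a transcript has the same distribution under both inputs, so its weight
  \<open>pmf R D\<close> factors out of the squared difference of square roots.\<close>

lemma hellinger_sq_tran:
  fixes \<mu>0 \<mu>1 :: "('a::finite ^ 'n::finite) pmf"
  assumes "finite (set_pmf R)"
  shows "hellinger_sq (tran R \<mu>0) (tran R \<mu>1) =
    (\<Sum>D\<in>set_pmf R. pmf R D * leaf_distance (pmf \<mu>0) (pmf \<mu>1) D UNIV) / 2"
proof -
  let ?h = "\<lambda>z. (sqrt (pmf (tran R \<mu>0) z) - sqrt (pmf (tran R \<mu>1) z))\<^sup>2"
  let ?m = "\<lambda>\<nu> D l. leaf_mass (pmf \<nu>) D UNIV l"
  let ?Z = "SIGMA D:set_pmf R. leaves D"
  have h: "?h (D, l) = pmf R D * (sqrt (?m \<mu>0 D l) - sqrt (?m \<mu>1 D l))\<^sup>2" for D l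
    by (simp add: pmf_tran real_sqrt_mult power_mult_distrib flip: right_diff_distrib)
  have "leaf_mass v D UNIV l = 0" if "l \<notin> leaves D" for v and D :: "('n, 'a) dtree" and l
  proof -
    have "{x. x \<in> UNIV \<and> leaf D x = l} = {}"
      using that leaf_in_leaves by auto
    then show ?thesis
      unfolding leaf_mass_def by simp
  qed
  then have zero: "?h z = 0" if "z \<notin> ?Z" for z
    using that by (cases z) (auto simp: h set_pmf_iff)
  have "infsum ?h UNIV = infsum ?h ?Z"
    by (rule infsum_cong_neutral) (use zero in auto)
  also have "\<dots> = sum ?h ?Z"
    by (rule infsum_finite) (use assms finite_leaves in auto)
  also have "\<dots> = (\<Sum>D\<in>set_pmf R. \<Sum>l\<in>leaves D. ?h (D, l))"
    by (subst sum.Sigma) (use assms finite_leaves in auto)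
  also have "\<dots> = (\<Sum>D\<in>set_pmf R. pmf R D * leaf_distance (pmf \<mu>0) (pmf \<mu>1) D UNIV)"
    by (simp add: h leaf_distance_def sum_distrib_left)
  finally show ?thesis
    by (simp add: hellinger_sq_def)
qed

section \<open>Amplification by repetition within a query budget\<close>

text \<open>The continuation \<open>k\<close> receives the forecast and the unspent budget, so that
  runs can be chained into one tree. The default \<open>d\<close> is output only when a further
  query would exceed the budget; a run that spends it exactly still completes.\<close>

primrec run_within ::
  "('n, 'a) ftree \<Rightarrow> nat \<Rightarrow> bool \<Rightarrow> (real \<Rightarrow> nat \<Rightarrow> ('n, 'a) dtree) \<Rightarrow> ('n, 'a) dtree" where
  "run_within (Forecast r) b d k = k r b"
| "run_within (Ask i t) b d k =
     (case b of 0 \<Rightarrow> Output d | Suc b' \<Rightarrow> Query i (\<lambda>c. run_within (t c) b' d k))"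

lemma tree_output_run_within:
  "tree_output (run_within t b d k) x =
     (if num_asks t x \<le> b then tree_output (k (forecast t x) (b - num_asks t x)) x else d)"
  by (induction t arbitrary: b) (auto split: nat.split)

lemma num_queries_run_within:
  "(\<And>r b. num_queries (k r b) x \<le> b) \<Longrightarrow> num_queries (run_within t b d k) x \<le> b"
  by (induction t arbitrary: b) (auto split: nat.split)

text \<open>\<open>v\<close> is the product of the forecasts of the completed runs. An interrupted
  run is discarded: its default output is the decision based on \<open>v\<close>.\<close>

fun amplify :: "('n, 'a) ftree list \<Rightarrow> real \<Rightarrow> nat \<Rightarrow> ('n, 'a) dtree" where
  "amplify [] v b = Output (1 \<le> v)"
| "amplify (t # ts) v b = run_within t b (1 \<le> v) (\<lambda>r. amplify ts (v * r))"

text \<open>The last value of \<open>v\<close> on one fixed input, with query counts and forecasts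
  as parameters, so that the same bounds apply to reciprocal forecasts.\<close>

fun final_ratio :: "('t \<Rightarrow> nat) \<Rightarrow> ('t \<Rightarrow> real) \<Rightarrow> 't list \<Rightarrow> real \<Rightarrow> nat \<Rightarrow> real" where
  "final_ratio q r [] v b = v"
| "final_ratio q r (t # ts) v b =
     (if q t \<le> b then final_ratio q r ts (v * r t) (b - q t) else v)"

lemma tree_output_amplify:
  "tree_output (amplify ts v b) x \<longleftrightarrow>
     1 \<le> final_ratio (\<lambda>t. num_asks t x) (\<lambda>t. forecast t x) ts v b"
  by (induction ts arbitrary: v b) (auto simp: tree_output_run_within)

lemma num_queries_amplify: "num_queries (amplify ts v b) x \<le> b"
  by (induction ts arbitrary: v b) (auto intro: num_queries_run_within)

text \<open>Turns the error on 1-inputs, a product below 1, into the error event of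
  0-inputs.\<close>

lemma final_ratio_inverse:
  "final_ratio q (\<lambda>t. 1 / r t) ts (1 / v) b = 1 / final_ratio q r ts v b"
proof (induction ts arbitrary: v b)
  case (Cons t ts)
  then show ?case
    using Cons[of "v * r t" "b - q t"] by simp
qed simp

lemma final_ratio_pos:
  "(\<And>t. t \<in> set ts \<Longrightarrow> 0 < r t) \<Longrightarrow> 0 < v \<Longrightarrow> 0 < final_ratio q r ts v b"
  by (induction ts arbitrary: v b) auto

text \<open>
  Ville's maximal inequality for the supermartingale of partial products: the last completed run is
  not a stopping time, so optional stopping would not apply.
\<close>

lemma prob_final_ratio_le:
  assumes fin: "finite (set_pmf p)" and r: "\<And>t. t \<in> set_pmf p \<Longrightarrow> 0 \<le> r t"
    and "(\<Sum>t\<in>set_pmf p. pmf p t * r t) \<le> 1" and "0 \<le> v"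
  shows "measure_pmf.prob (replicate_pmf n p) {ts. 1 \<le> final_ratio q r ts v b} \<le> v"
  using \<open>0 \<le> v\<close>
proof (induction n arbitrary: v b)
  case 0
  then show ?case
    by (auto simp: indicator_def)
next
  case (Suc n)
  show ?case
  proof (cases "1 \<le> v")
    case True
    then show ?thesis
      by (meson measure_pmf.prob_le_1 order_trans)
  next
    case False
    have "measure_pmf.prob (replicate_pmf (Suc n) p) {ts. 1 \<le> final_ratio q r ts v b} \<le>
        (\<Sum>t\<in>set_pmf p. pmf p t * (v * r t))"
      unfolding prob_replicate_pmf_Suc[OF fin]
    proof (intro sum_mono mult_left_mono)
      \<comment> \<open>A first run that does not fit leaves the ratio at \<open>v < 1\<close>, so
        the event is impossible; otherwise the induction hypothesis applies to
        \<open>v * r t\<close>.\<close>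
      fix t assume "t \<in> set_pmf p"
      then show "measure_pmf.prob (replicate_pmf n p) {ts. 1 \<le> final_ratio q r (t # ts) v b} \<le> v * r t"
        using False Suc r[of t] by (cases "q t \<le> b") auto
    qed auto
    also have "\<dots> = v * (\<Sum>t\<in>set_pmf p. pmf p t * r t)"
      by (simp add: sum_distrib_left mult.left_commute)
    also have "\<dots> \<le> v"
      using assms(3) Suc.prems by (simp add: mult_left_le)
    finally show ?thesis .
  qed
qed

text \<open>One induction carries two error bounds. If \<open>m\<close> runs complete, the expected
  product is damped to \<open>v * \<rho> ^ m\<close> and the maximal inequality applies. Failing to
  complete them takes a demand of at least \<open>B + 1\<close> queries, of which
  \<open>B - b\<close> are already spent; this is Markov's inequality.\<close>

lemma prob_final_ratio_le_budget:
  fixes b B :: nat and \<rho> c :: real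
  assumes fin: "finite (set_pmf p)" and r: "\<And>t. t \<in> set_pmf p \<Longrightarrow> 0 \<le> r t"
    and Er: "(\<Sum>t\<in>set_pmf p. pmf p t * r t) \<le> \<rho>" and "\<rho> \<le> 1"
    and Eq: "(\<Sum>t\<in>set_pmf p. pmf p t * q t) \<le> c"
    and "m \<le> n" and "b \<le> B" and "0 \<le> v"
  shows "measure_pmf.prob (replicate_pmf n p) {ts. 1 \<le> final_ratio q r ts v b}
    \<le> v * \<rho> ^ m + (m * c + (real B - real b)) / (real B + 1)"
  using \<open>m \<le> n\<close> \<open>b \<le> B\<close> \<open>0 \<le> v\<close>
proof (induction m arbitrary: n v b)
  case 0
  have "measure_pmf.prob (replicate_pmf n p) {ts. 1 \<le> final_ratio q r ts v b} \<le> v"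
    using prob_final_ratio_le[OF fin r] Er \<open>\<rho> \<le> 1\<close> \<open>0 \<le> v\<close> by fastforce
  then show ?case
    using 0 by (simp add: add_increasing2)
next
  case (Suc m)
  then obtain n' where n: "n = Suc n'" "m \<le> n'"
    by (cases n) auto
  have "0 \<le> \<rho>"
  proof -
    have "0 \<le> (\<Sum>t\<in>set_pmf p. pmf p t * r t)"
      using r by (simp add: sum_nonneg)
    then show ?thesis
      using Er by linarith
  qed
  have sum1: "(\<Sum>t\<in>set_pmf p. pmf p t) = 1"
    using sum_pmf_eq_1[OF fin order.refl] .
  let ?K = "(m * c + (real B - real b)) / (real B + 1)"
  have "measure_pmf.prob (replicate_pmf (Suc n') p) {ts. 1 \<le> final_ratio q r ts v b} \<le>
      (\<Sum>t\<in>set_pmf p. pmf p t * (v * r t * \<rho> ^ m + (m * c + (real B - real b + q t)) / (real B + 1)))"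
    unfolding prob_replicate_pmf_Suc[OF fin]
  proof (intro sum_mono mult_left_mono)
    fix t assume t: "t \<in> set_pmf p"
    show "measure_pmf.prob (replicate_pmf n' p) {ts. 1 \<le> final_ratio q r (t # ts) v b} \<le>
        v * r t * \<rho> ^ m + (m * c + (real B - real b + q t)) / (real B + 1)"
    proof (cases "q t \<le> b")
      case True
      then show ?thesis
        using Suc.IH[OF n(2), of "b - q t" "v * r t"] Suc.prems r[OF t]
        by (simp add: of_nat_diff algebra_simps)
    next
      case False
      have "0 \<le> (\<Sum>t\<in>set_pmf p. pmf p t * q t)"
        by (simp add: sum_nonneg)
      then have "0 \<le> m * c"
        using Eq by simp
      \<comment> \<open>An interrupted run asks at least \<open>b + 1\<close> queries, so the
        fraction alone exceeds the trivial bound 1.\<close>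
      then have "1 \<le> (m * c + (real B - real b + q t)) / (real B + 1)"
        using False by (simp add: field_simps)
      moreover have "0 \<le> v * r t * \<rho> ^ m"
        using r[OF t] \<open>0 \<le> \<rho>\<close> Suc.prems by simp
      moreover have "measure_pmf.prob (replicate_pmf n' p) {ts. 1 \<le> final_ratio q r (t # ts) v b} \<le> 1"
        by simp
      ultimately show ?thesis
        by linarith
    qed
  qed auto
  also have "\<dots> = (\<Sum>t\<in>set_pmf p. v * \<rho> ^ m * (pmf p t * r t) + ?K * pmf p t + pmf p t * q t / (real B + 1))"
    by (rule sum.cong) (simp_all add: algebra_simps add_divide_distrib diff_divide_distrib)
  also have "\<dots> = v * \<rho> ^ m * (\<Sum>t\<in>set_pmf p. pmf p t * r t) + ?K
      + (\<Sum>t\<in>set_pmf p. pmf p t * q t) / (real B + 1)"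
    using sum1 by (simp add: sum.distrib flip: sum_distrib_left sum_divide_distrib)
  also have "\<dots> \<le> v * \<rho> ^ m * \<rho> + ?K + c / (real B + 1)"
    using Er Eq \<open>0 \<le> \<rho>\<close> Suc.prems by (intro add_mono mult_left_mono divide_right_mono) auto
  also have "\<dots> = v * \<rho> ^ Suc m + (Suc m * c + (real B - real b)) / (real B + 1)"
    by (simp add: algebra_simps add_divide_distrib diff_divide_distrib)
  finally show ?case
    by (simp add: n)
qed

lemma prob_final_ratio_le_third:
  fixes s :: real and B :: nat
  assumes fin: "finite (set_pmf p)" and r: "\<And>t. t \<in> set_pmf p \<Longrightarrow> 0 \<le> r t"
    and Er: "(\<Sum>t\<in>set_pmf p. pmf p t * r t) = 1 - s" and "0 < s"
    and Eq: "(\<Sum>t\<in>set_pmf p. pmf p t * q t) \<le> (real B + 1) / 240 * s"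
    and n: "nat \<lceil>2 / s\<rceil> \<le> n"
  shows "measure_pmf.prob (replicate_pmf n p) {ts. 1 \<le> final_ratio q r ts 1 B} \<le> 1 / 3"
proof -
  \<comment> \<open>With \<open>m * s\<close> between 2 and 3, the product term is at most
    \<open>exp (- 2) \<le> 1 / 4\<close> and the budget term at most 3/240; together they stay below
    1/3. Only the analysis depends on \<open>m\<close>.\<close>
  define m where "m = nat \<lceil>2 / s\<rceil>"
  have "0 \<le> (\<Sum>t\<in>set_pmf p. pmf p t * r t)"
    using r by (simp add: sum_nonneg)
  then have "s \<le> 1"
    using Er by simp
  have m: "2 / s \<le> m" "m \<le> 2 / s + 1"
    using \<open>0 < s\<close> by (auto simp: m_def of_nat_nat intro: real_nat_ceiling_ge)
  then have ms: "2 \<le> m * s" "m * s \<le> 3"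
    using \<open>0 < s\<close> \<open>s \<le> 1\<close> by (auto simp: field_simps)
  have "(1 - s) ^ m \<le> exp (- s) ^ m"
    using exp_ge_add_one_self[of "- s"] \<open>s \<le> 1\<close> by (intro power_mono) auto
  also have "\<dots> = exp (- (m * s))"
    by (simp flip: exp_of_nat_mult)
  also have "\<dots> \<le> exp (- 2)"
    using ms by simp
  also have "\<dots> \<le> 1 / 4"
  proof -
    have "(2 :: real) * 2 \<le> exp 1 * exp 1"
      using exp_ge_add_one_self[of "1 :: real"] by (intro mult_mono) auto
    then have "(4 :: real) \<le> exp 2"
      by (simp flip: exp_add)
    then show ?thesis
      by (simp add: exp_minus field_simps)
  qed
  finally have "(1 - s) ^ m \<le> 1 / 4" .
  moreover have "m * ((real B + 1) / 240 * s) / (real B + 1) \<le> 3 / 240"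
  proof -
    have "m * ((real B + 1) / 240 * s) / (real B + 1) = m * s / 240"
      by (simp add: field_simps)
    then show ?thesis
      using ms by (simp only:)
  qed
  moreover have "measure_pmf.prob (replicate_pmf n p) {ts. 1 \<le> final_ratio q r ts 1 B}
    \<le> 1 * (1 - s) ^ m + (m * ((real B + 1) / 240 * s) + (real B - real B)) / (real B + 1)"
    by (rule prob_final_ratio_le_budget[OF fin r _ _ Eq]) (use Er \<open>0 < s\<close> n in \<open>auto simp: m_def\<close>)
  ultimately show ?thesis
    by (simp only: mult_1 diff_self add_0_right)
qed

text \<open>The expected forecast on a 0-input and the expected reciprocal forecast on a 1-input
  both equal one minus the expected score, so one tail bound serves both.\<close>

lemma forecasters_to_algorithm:
  fixes P :: "('n::finite, 'a::finite) ftree pmf" and B :: nat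
  assumes fin: "finite (set_pmf P)" and pos: "\<And>t. t \<in> set_pmf P \<Longrightarrow> positive_forecasts t"
    and good: "\<And>x. x \<in> S \<Longrightarrow> measure_pmf.expectation P (\<lambda>t. num_asks t x)
      < (real B + 1) / 240 * measure_pmf.expectation P (\<lambda>t. score f t x)"
  obtains R where "randomized_query_algorithm R" and "computes R S f"
    and "\<And>D x. D \<in> set_pmf R \<Longrightarrow> num_queries D x \<le> B"
proof -
  define s where "s x = measure_pmf.expectation P (\<lambda>t. score f t x)" for x
  \<comment> \<open>A common upper bound on the repetitions that the individual inputs require; the
    budget \<open>B\<close> limits the queries regardless.\<close>
  define n where "n = (\<Sum>x\<in>S. nat \<lceil>2 / s x\<rceil>)"
  define R where "R = map_pmf (\<lambda>ts. amplify ts 1 B) (replicate_pmf n P)"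
  have "measure_pmf.prob R {D. tree_output D x = f x} \<ge> 2 / 3" if "x \<in> S" for x
  proof -
    let ?q = "\<lambda>t. num_asks t x" and ?r = "\<lambda>t. forecast t x"
    have asks: "measure_pmf.expectation P (\<lambda>t. num_asks t x) = (\<Sum>t\<in>set_pmf P. pmf P t * num_asks t x)"
      using expectation_finite[OF fin order.refl] .
    have s: "s x = (\<Sum>t\<in>set_pmf P. pmf P t * score f t x)"
      unfolding s_def using expectation_finite[OF fin order.refl] .
    have Eq: "(\<Sum>t\<in>set_pmf P. pmf P t * num_asks t x) \<le> (real B + 1) / 240 * s x"
      using good[OF that] unfolding asks s_def by simp
    have "0 \<le> (\<Sum>t\<in>set_pmf P. pmf P t * num_asks t x)"
      by (simp add: sum_nonneg)
    then have "0 < (real B + 1) / 240 * s x"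
      using good[OF that] unfolding asks s_def by simp
    then have "0 < s x"
      by (simp add: zero_less_mult_iff)
    have n: "nat \<lceil>2 / s x\<rceil> \<le> n"
      unfolding n_def by (rule member_le_sum) (use that in auto)
    have sum1: "(\<Sum>t\<in>set_pmf P. pmf P t) = 1"
      using sum_pmf_eq_1[OF fin order.refl] .
    have rpos: "0 < ?r t" if "t \<in> set_pmf P" for t
      using pos[OF that] by (simp add: positive_forecasts_def)
    have err: "measure_pmf.prob (replicate_pmf n P) {ts. tree_output (amplify ts 1 B) x \<noteq> f x} \<le> 1 / 3"
    proof (cases "f x")
      case False
      have "(\<Sum>t\<in>set_pmf P. pmf P t * ?r t) = 1 - s x"
        using sum1 False by (simp add: s score_def right_diff_distrib sum_subtractf)
      then have "measure_pmf.prob (replicate_pmf n P) {ts. 1 \<le> final_ratio ?q ?r ts 1 B} \<le> 1 / 3"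
        using rpos by (intro prob_final_ratio_le_third[OF fin _ _ \<open>0 < s x\<close> Eq n]) (auto intro: less_imp_le)
      then show ?thesis
        using False by (simp add: tree_output_amplify)
    next
      case True
      have "(\<Sum>t\<in>set_pmf P. pmf P t * (1 / ?r t)) = 1 - s x"
        using sum1 True by (simp add: s score_def right_diff_distrib sum_subtractf)
      then have le: "measure_pmf.prob (replicate_pmf n P) {ts. 1 \<le> final_ratio ?q (\<lambda>t. 1 / ?r t) ts 1 B} \<le> 1 / 3"
        using rpos by (intro prob_final_ratio_le_third[OF fin _ _ \<open>0 < s x\<close> Eq n]) (auto intro: less_imp_le)
      \<comment> \<open>Taking reciprocals needs a positive product, which is known only on the
        support, hence the almost-sure inclusion.\<close>
      have "measure_pmf.prob (replicate_pmf n P) {ts. tree_output (amplify ts 1 B) x \<noteq> f x} \<le>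
          measure_pmf.prob (replicate_pmf n P) {ts. 1 \<le> final_ratio ?q (\<lambda>t. 1 / ?r t) ts 1 B}"
      proof (rule measure_pmf.finite_measure_mono_AE)
        show "AE ts in replicate_pmf n P. ts \<in> {ts. tree_output (amplify ts 1 B) x \<noteq> f x} \<longrightarrow>
            ts \<in> {ts. 1 \<le> final_ratio ?q (\<lambda>t. 1 / ?r t) ts 1 B}"
          unfolding AE_measure_pmf_iff
        proof (intro ballI impI)
          fix ts assume ts: "ts \<in> set_pmf (replicate_pmf n P)"
            and "ts \<in> {ts. tree_output (amplify ts 1 B) x \<noteq> f x}"
          then have "final_ratio ?q ?r ts 1 B < 1"
            using True by (simp add: tree_output_amplify)
          moreover have "0 < final_ratio ?q ?r ts 1 B"
            using set_replicate_pmf_subset[OF ts] rpos by (intro final_ratio_pos) auto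
          ultimately show "ts \<in> {ts. 1 \<le> final_ratio ?q (\<lambda>t. 1 / ?r t) ts 1 B}"
            using final_ratio_inverse[of ?q ?r ts 1 B] by simp
        qed
      qed auto
      then show ?thesis
        using le by linarith
    qed
    have "measure_pmf.prob R {D. tree_output D x = f x} =
        1 - measure_pmf.prob (replicate_pmf n P) {ts. tree_output (amplify ts 1 B) x \<noteq> f x}"
      using measure_pmf.prob_compl[of "{ts. tree_output (amplify ts 1 B) x \<noteq> f x}" "replicate_pmf n P"]
      by (simp add: R_def vimage_def Collect_neg_eq[symmetric] Compl_eq_Diff_UNIV[symmetric])
    then show ?thesis
      using err by linarith
  qed
  then have "computes R S f"
    by (simp add: computes_def)
  moreover have "randomized_query_algorithm R"
    using fin by (simp add: randomized_query_algorithm_def R_def finite_set_replicate_pmf)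
  moreover have "num_queries D x \<le> B" if "D \<in> set_pmf R" for D x
    using that num_queries_amplify by (auto simp: R_def)
  ultimately show thesis
    using that by blast
qed

lemma randomized_query_complexity_le:
  fixes S :: "('a::finite ^ 'n::finite) set"
  assumes "S \<noteq> {}" and R: "randomized_query_algorithm R" "computes R S f"
    and le: "\<And>D x. D \<in> set_pmf R \<Longrightarrow> num_queries D x \<le> B"
  shows "randomized_query_complexity S f \<le> B"
proof -
  let ?N = "{num_queries D x | D x. D \<in> set_pmf R \<and> x \<in> S}"
  have "?N = (\<lambda>(D, x). num_queries D x) ` (set_pmf R \<times> S)"
    by auto
  moreover have "finite (set_pmf R)"
    using R(1) by (simp add: randomized_query_algorithm_def)
  ultimately have "finite ?N" "?N \<noteq> {}"
    using \<open>S \<noteq> {}\<close> set_pmf_not_empty[of R] by auto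
  then have "worst_case_queries R S \<le> B"
    unfolding worst_case_queries_def using le by auto
  moreover have "randomized_query_complexity S f \<le> worst_case_queries R S"
    unfolding randomized_query_complexity_def using R by (intro Least_le) blast
  ultimately show ?thesis
    by simp
qed

section \<open>Existence of hard distributions\<close>

text \<open>Cost and distance are averages over the same \<open>R\<close>, so some tree in its
  support does as well as the average. A finite \<open>ratio\<close> rules out distance 0. The
  factor 2 undoes the 1/2 in \<open>hellinger_sq\<close>.\<close>

lemma bad_tree:
  fixes \<mu>0 \<mu>1 :: "('a::finite ^ 'n::finite) pmf"
  assumes R: "randomized_query_algorithm R"
    and lt: "ratio (min (cost R \<mu>0) (cost R \<mu>1)) (hellinger_sq (tran R \<mu>0) (tran R \<mu>1)) < ereal c"
  obtains D \<nu> where "\<nu> = \<mu>0 \<or> \<nu> = \<mu>1"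
    and "2 * (\<Sum>x\<in>UNIV. pmf \<nu> x * num_queries D x) < c * leaf_distance (pmf \<mu>0) (pmf \<mu>1) D UNIV"
proof -
  let ?h = "hellinger_sq (tran R \<mu>0) (tran R \<mu>1)"
  have fin: "finite (set_pmf R)"
    using R by (simp add: randomized_query_algorithm_def)
  have "0 \<le> ?h"
    unfolding hellinger_sq_tran[OF fin] leaf_distance_def by (simp add: sum_nonneg)
  moreover have "?h \<noteq> 0" "min (cost R \<mu>0) (cost R \<mu>1) / ?h < c"
    using lt by (auto simp: ratio_def split: if_splits)
  ultimately have "min (cost R \<mu>0) (cost R \<mu>1) < c * ?h"
    by (simp add: field_simps)
  then obtain \<nu> where \<nu>: "\<nu> = \<mu>0 \<or> \<nu> = \<mu>1" "cost R \<nu> < c * ?h"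
    by (metis min_less_iff_disj)
  have "\<exists>D\<in>set_pmf R. 2 * (\<Sum>x\<in>UNIV. pmf \<nu> x * num_queries D x) <
      c * leaf_distance (pmf \<mu>0) (pmf \<mu>1) D UNIV"
  proof (rule ccontr)
    assume "\<not> ?thesis"
    then have "(\<Sum>D\<in>set_pmf R. pmf R D * (c * leaf_distance (pmf \<mu>0) (pmf \<mu>1) D UNIV)) \<le>
        (\<Sum>D\<in>set_pmf R. pmf R D * (2 * (\<Sum>x\<in>UNIV. pmf \<nu> x * num_queries D x)))"
      by (intro sum_mono mult_left_mono) (auto simp: not_less)
    then have "c * (2 * ?h) \<le> 2 * cost R \<nu>"
      unfolding hellinger_sq_tran[OF fin] cost_eq_sum[OF fin]
      by (simp add: mult.left_commute[of "pmf _ _"] flip: sum_distrib_left)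
    then show False
      using \<nu>(2) by simp
  qed
  then show thesis
    using that \<nu>(1) by blast
qed

text \<open>If the masses differed, the constant given by \<open>best_forecast\<close> would have a
  positive total score.\<close>

lemma hard_weights_balanced:
  fixes p q :: real
  assumes "0 \<le> p" and "0 \<le> q" and "\<And>r. 0 < r \<Longrightarrow> p * (1 - r) + q * (1 - 1 / r) \<le> 0"
  shows "p = q"
  using best_forecast[OF assms(1,2)] assms(3) by (metis not_less)

theorem theorem4p6:
  fixes S :: "(('a::finite) ^ ('n::finite)) set" and f :: "'a ^ 'n \<Rightarrow> bool"
  assumes "\<not> f constant_on S"
  shows "\<exists>\<mu>0 \<mu>1 :: ('a ^ 'n) pmf.
           set_pmf \<mu>0 \<subseteq> {x \<in> S. f x = False} \<and> set_pmf \<mu>1 \<subseteq> {x \<in> S. f x = True} \<and>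
           (\<forall>R :: ('n, 'a) dtree pmf. randomized_query_algorithm R \<longrightarrow>
              ratio (min (cost R \<mu>0) (cost R \<mu>1)) (hellinger_sq (tran R \<mu>0) (tran R \<mu>1))
                \<ge> ereal (real (randomized_query_complexity S f) / 3000))"
proof (rule ccontr)
  assume no_hard: "\<not> ?thesis"
  define T where "T = randomized_query_complexity S f"
  have bad: "\<exists>R :: ('n, 'a) dtree pmf. randomized_query_algorithm R \<and>
      ratio (min (cost R \<mu>0) (cost R \<mu>1)) (hellinger_sq (tran R \<mu>0) (tran R \<mu>1)) < ereal (T / 3000)"
    if "set_pmf \<mu>0 \<subseteq> {x \<in> S. f x = False}" "set_pmf \<mu>1 \<subseteq> {x \<in> S. f x = True}"
    for \<mu>0 \<mu>1 :: "('a ^ 'n) pmf"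
    using no_hard that unfolding T_def not_le[symmetric] by blast
  have "S \<noteq> {}"
    using assms by (auto simp: constant_on_def)
  have "\<exists>x\<in>S. f x \<noteq> y" for y
    using assms by (auto simp: constant_on_def)
  from this[of True] this[of False]
  obtain x0 x1 where "x0 \<in> {x \<in> S. f x = False}" "x1 \<in> {x \<in> S. f x = True}"
    by blast
  \<comment> \<open>Two point masses suffice to exclude \<open>T = 0\<close>, which would make a
    nonnegative cost negative.\<close>
  then obtain R :: "('n, 'a) dtree pmf" where "randomized_query_algorithm R"
    "ratio (min (cost R (return_pmf x0)) (cost R (return_pmf x1)))
      (hellinger_sq (tran R (return_pmf x0)) (tran R (return_pmf x1))) < ereal (T / 3000)"
    using bad[of "return_pmf x0" "return_pmf x1"] by auto
  then obtain D and \<nu> :: "('a ^ 'n) pmf" where "2 * (\<Sum>x\<in>UNIV. pmf \<nu> x * num_queries D x) <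
      T / 3000 * leaf_distance (pmf (return_pmf x0)) (pmf (return_pmf x1)) D UNIV"
    using bad_tree by blast
  moreover have "0 \<le> (\<Sum>x\<in>UNIV. pmf \<nu> x * num_queries D x)"
    by (simp add: sum_nonneg)
  ultimately have "T \<noteq> 0"
    by (intro notI) simp
  \<comment> \<open>The payoff of a forecaster in the game against the inputs; 240 is the constant
    that the amplification tolerates.\<close>
  define g where "g t x = T / 240 * score f t x - num_asks t x" for t :: "('n, 'a) ftree" and x
  have "Forecast 1 \<in> Collect positive_forecasts"
    by (simp add: positive_forecasts_def)
  then have "Collect positive_forecasts \<noteq> ({} :: ('n, 'a) ftree set)"
    by blast
  then show False
  proof (cases rule: mixture_or_weights[where S = S and g = g])
    case (mixture P)
    \<comment> \<open>The budget is \<open>B = T - 1\<close>, so that \<open>real B + 1\<close> is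
      \<open>T\<close> and success contradicts the minimality of \<open>T\<close>.\<close>
    obtain B where B: "T = Suc B"
      using \<open>T \<noteq> 0\<close> by (cases T) auto
    have "measure_pmf.expectation P (\<lambda>t. num_asks t x) <
        (real B + 1) / 240 * measure_pmf.expectation P (\<lambda>t. score f t x)" if "x \<in> S" for x
    proof -
      have "measure_pmf.expectation P (\<lambda>t. g t x) =
          T / 240 * measure_pmf.expectation P (\<lambda>t. score f t x) - measure_pmf.expectation P (\<lambda>t. num_asks t x)"
        unfolding expectation_finite[OF mixture(1) order.refl] g_def
        by (simp add: right_diff_distrib sum_subtractf sum_distrib_left mult.left_commute)
      then show ?thesis
        using mixture(3)[OF that] by (simp add: B add.commute)
    qed
    then obtain R where "randomized_query_algorithm R" "computes R S f"
      "\<And>D x. D \<in> set_pmf R \<Longrightarrow> num_queries D x \<le> B"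
      using forecasters_to_algorithm[OF mixture(1)] mixture(2) by blast
    then have "T \<le> B"
      unfolding T_def using \<open>S \<noteq> {}\<close> by (intro randomized_query_complexity_le)
    then show False
      by (simp add: B)
  next
    case (weights a)
    let ?X0 = "{x \<in> S. f x = False}" and ?X1 = "{x \<in> S. f x = True}"
    have split: "(\<Sum>x\<in>UNIV. a x * h x) = (\<Sum>x\<in>?X0. a x * h x) + (\<Sum>x\<in>?X1. a x * h x)"
      for h :: "'a ^ 'n \<Rightarrow> real"
    proof -
      have "(\<Sum>x\<in>UNIV. a x * h x) = (\<Sum>x\<in>?X0 \<union> ?X1. a x * h x)"
        by (rule sum.mono_neutral_right) (use weights(2) in auto)
      also have "\<dots> = (\<Sum>x\<in>?X0. a x * h x) + (\<Sum>x\<in>?X1. a x * h x)"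
        by (rule sum.union_disjoint) auto
      finally show ?thesis .
    qed
    have "sum a ?X0 = sum a ?X1"
    proof (rule hard_weights_balanced)
      fix r :: real assume "0 < r"
      then have "(\<Sum>x\<in>UNIV. a x * g (Forecast r) x) \<le> 0"
        by (intro weights(4)) (simp add: positive_forecasts_def)
      moreover have "(\<Sum>x\<in>UNIV. a x * g (Forecast r) x) =
          T / 240 * (sum a ?X0 * (1 - r) + sum a ?X1 * (1 - 1 / r))"
        unfolding split by (simp add: g_def score_def sum_distrib_left sum_distrib_right algebra_simps)
      ultimately show "sum a ?X0 * (1 - r) + sum a ?X1 * (1 - 1 / r) \<le> 0"
        using \<open>T \<noteq> 0\<close> by (simp add: mult_le_0_iff)
    qed (simp_all add: sum_nonneg weights(1))
    moreover define W where "W = sum a ?X0"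
    ultimately have W: "sum a ?X0 = W" "sum a ?X1 = W"
      by simp_all
    have "0 < sum a UNIV"
      using weights(1,3) by (simp add: order_less_le sum_nonneg sum_nonneg_eq_0_iff)
    then have "0 < W"
      using split[of "\<lambda>_. 1"] W by simp
    \<comment> \<open>Since both halves are divided by the same \<open>W\<close>,
      \<open>pmf \<mu>0 x + pmf \<mu>1 x = a x / W\<close>, and the inequality for \<open>a\<close>
      becomes one about the two distributions.\<close>
    have norm: "\<exists>\<mu>. set_pmf \<mu> \<subseteq> X \<and> (\<forall>x. pmf \<mu> x = (if x \<in> X then a x / W else 0))" if "sum a X = W" for X
    proof -
      have "sum (\<lambda>x. a x / W) X = 1"
        using that \<open>0 < W\<close> by (simp flip: sum_divide_distrib)
      moreover have "0 \<le> a x / W" for x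
        using weights(1) \<open>0 < W\<close> by simp
      ultimately obtain \<mu> where "set_pmf \<mu> \<subseteq> X" "\<And>x. pmf \<mu> x = (if x \<in> X then a x / W else 0)"
        using pmf_of_weights[of X "\<lambda>x. a x / W"] by auto
      then show ?thesis
        by blast
    qed
    obtain \<mu>0 where \<mu>0: "set_pmf \<mu>0 \<subseteq> ?X0" "\<And>x. pmf \<mu>0 x = (if x \<in> ?X0 then a x / W else 0)"
      using norm[OF W(1)] by blast
    obtain \<mu>1 where \<mu>1: "set_pmf \<mu>1 \<subseteq> ?X1" "\<And>x. pmf \<mu>1 x = (if x \<in> ?X1 then a x / W else 0)"
      using norm[OF W(2)] by blast
    obtain R :: "('n, 'a) dtree pmf" where R: "randomized_query_algorithm R"
      "ratio (min (cost R \<mu>0) (cost R \<mu>1)) (hellinger_sq (tran R \<mu>0) (tran R \<mu>1)) < ereal (T / 3000)"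
      using bad[OF \<mu>0(1) \<mu>1(1)] by blast
    obtain D \<nu> where \<nu>: "\<nu> = \<mu>0 \<or> \<nu> = \<mu>1" and D:
      "2 * (\<Sum>x\<in>UNIV. pmf \<nu> x * num_queries D x) < T / 3000 * leaf_distance (pmf \<mu>0) (pmf \<mu>1) D UNIV"
      using bad_tree[OF R] by blast
    have "pmf \<nu> = pmf \<mu>0 \<or> pmf \<nu> = pmf \<mu>1"
      using \<nu> by blast
    then obtain t where t: "positive_forecasts t"
      "leaf_distance (pmf \<mu>0) (pmf \<mu>1) D UNIV \<le>
        5 * (\<Sum>x\<in>UNIV. pmf \<mu>0 x * (1 - forecast t x) + pmf \<mu>1 x * (1 - 1 / forecast t x))"
      "(\<Sum>x\<in>UNIV. (pmf \<mu>0 x + pmf \<mu>1 x) * num_asks t x) \<le> 5 * (\<Sum>x\<in>UNIV. pmf \<nu> x * num_queries D x)"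
      by (rule cheap_forecaster[of "pmf \<mu>0" "pmf \<mu>1" "pmf \<nu>" D, OF pmf_nonneg pmf_nonneg])
    let ?s = "\<Sum>x\<in>UNIV. pmf \<mu>0 x * (1 - forecast t x) + pmf \<mu>1 x * (1 - 1 / forecast t x)"
    let ?n = "\<Sum>x\<in>UNIV. (pmf \<mu>0 x + pmf \<mu>1 x) * num_asks t x"
    \<comment> \<open>The constants combine as 5 (cost) times 5 (distance) times 1/2 (from
      \<open>D\<close>) times 1/3000, which is 1/240.\<close>
    have "T / 3000 * leaf_distance (pmf \<mu>0) (pmf \<mu>1) D UNIV \<le> T / 3000 * (5 * ?s)"
      by (rule mult_left_mono[OF t(2)]) simp
    then have "?n < T / 240 * ?s"
      using D t(3) by simp
    moreover have "T / 240 * ?s - ?n = (\<Sum>x\<in>UNIV. a x / W * g t x)"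
    proof -
      have "a x / W * g t x = T / 240 * (pmf \<mu>0 x * (1 - forecast t x) + pmf \<mu>1 x * (1 - 1 / forecast t x))
          - (pmf \<mu>0 x + pmf \<mu>1 x) * num_asks t x" for x
        using weights(2)[of x] by (simp add: g_def score_def \<mu>0(2) \<mu>1(2) algebra_simps diff_divide_distrib)
      then show ?thesis
        by (simp only: sum_subtractf sum_distrib_left)
    qed
    moreover have "(\<Sum>x\<in>UNIV. a x / W * g t x) = (\<Sum>x\<in>UNIV. a x * g t x) / W"
      by (simp add: sum_divide_distrib)
    ultimately have "0 < (\<Sum>x\<in>UNIV. a x * g t x) / W"
      by simp
    then have "0 < (\<Sum>x\<in>UNIV. a x * g t x)"
      using \<open>0 < W\<close> by (simp add: zero_less_divide_iff)
    then show False
      using weights(4)[of t] t(1) by simp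
  qed
qed

end
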